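(* Let $(\mathfrak{g},[-,-]_1,[-,-]_2)$ be a compatible Lie algebra. Then there is a structure of a compatible anti-pre-Lie algebra on $(\mathfrak{g},[-,-]_1,[-,-]_2)$ if and only if there exists an invertible anti-$\mathcal{O}$-operator of $(\mathfrak{g},[-,-]_1,[-,-]_2)$ (associated to some representation $(\rho,\mu,V)$).
   Context: All vector spaces and algebras are finite-dimensional over $\mathbb{C}$. An anti-pre-Lie algebra is a vector space $A$ with a bilinear operation $\cdot$ such that, with $[x,y]=x\cdot y-y\cdot x$, for all $x,y,z\in A$: $x\cdot(y\cdot z)-y\cdot(x\cdot z)=[y,x]\cdot z$ and $[x,y]\cdot z+[y,z]\cdot x+[z,x]\cdot y=0$. $(A,\circ,\ast)$ is a compatible anti-pre-Lie algebra if $(A,\circ)$ and $(A,\ast)$ are anti-pre-Lie algebras and for all $k_1,k_2\in\mathbb{C}$ the operation $k_1x\circ y+k_2x\ast y$ makes $A$ an anti-pre-Lie algebra. A compatible Lie algebra $(\mathfrak{g},[-,-]_1,[-,-]_2)$ is a vector space with two Lie brackets such that $k_1[-,-]_1+k_2[-,-]_2$ is a Lie bracket for all $k_1,k_2\in\mathbb{C}$. A structure of a compatible anti-pre-Lie algebra on $(\mathfrak{g},[-,-]_1,[-,-]_2)$ is a compatible anti-pre-Lie algebra $(\mathfrak{g},\circ,\ast)$ on the same vector space with $[x,y]_1=x\circ y-y\circ x$ and $[x,y]_2=x\ast y-y\ast x$ for all $x,y\in\mathfrak{g}$. A representation $(\rho,\mu,V)$ of a compatible Lie algebra is a vector space $V$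 with linear maps $\rho,\mu:\mathfrak{g}\to\mathfrak{gl}(V)$ such that for all $k_1,k_2\in\mathbb{C}$, $k_1\rho+k_2\mu$ is a representation of the Lie algebra $(\mathfrak{g},k_1[-,-]_1+k_2[-,-]_2)$. A linear map $T:V\to\mathfrak{g}$ is an anti-$\mathcal{O}$-operator associated to $(\rho,\mu,V)$ if for all $k_1,k_2\in\mathbb{C}$, writing $[-,-]=k_1[-,-]_1+k_2[-,-]_2$ and $\sigma=k_1\rho+k_2\mu$, one has $[T(u),T(v)]=T(\sigma(T(v))u-\sigma(T(u))v)$ for all $u,v\in V$. *)

theory Defs
  imports "Jordan_Normal_Form.VS_Connect" "HOL.Complex"
begin

abbreviation complex_field :: "complex ring" where
  "complex_field \<equiv> class_ring"

text \<open>
  Vector spaces are records with an explicit carrier, so that a theorem can quantify existentially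
  over the space on which a Lie algebra is represented.  All operations, brackets and actions are
  total functions of which only the values on the carriers matter.
\<close>

definition fd_vectorspace :: "(complex, 'a) module \<Rightarrow> bool" where
  "fd_vectorspace V \<longleftrightarrow> vectorspace complex_field V \<and> vectorspace.fin_dim complex_field V"

definition bilinear_map ::
  "(complex, 'a) module \<Rightarrow> (complex, 'b) module \<Rightarrow> (complex, 'c) module \<Rightarrow>
    ('a \<Rightarrow> 'b \<Rightarrow> 'c) \<Rightarrow> bool" where
  "bilinear_map U V W m \<longleftrightarrow>
    (\<forall>x\<in>carrier U. linear_map complex_field V W (m x)) \<and>
    (\<forall>y\<in>carrier V. linear_map complex_field U W (\<lambda>x. m x y))"

definition pencil ::
  "(complex, 'c) module \<Rightarrow> complex \<Rightarrow> ('a \<Rightarrow> 'b \<Rightarrow> 'c) \<Rightarrow> complex \<Rightarrow> ('a \<Rightarrow> 'b \<Rightarrow> 'c) \<Rightarrow>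
    'a \<Rightarrow> 'b \<Rightarrow> 'c" where
  "pencil W k1 m1 k2 m2 = (\<lambda>x y. k1 \<odot>\<^bsub>W\<^esub> m1 x y \<oplus>\<^bsub>W\<^esub> k2 \<odot>\<^bsub>W\<^esub> m2 x y)"

definition commutator :: "(complex, 'a) module \<Rightarrow> ('a \<Rightarrow> 'a \<Rightarrow> 'a) \<Rightarrow> 'a \<Rightarrow> 'a \<Rightarrow> 'a" where
  "commutator A m = (\<lambda>x y. m x y \<ominus>\<^bsub>A\<^esub> m y x)"

definition lie_algebra :: "(complex, 'a) module \<Rightarrow> ('a \<Rightarrow> 'a \<Rightarrow> 'a) \<Rightarrow> bool" where
  "lie_algebra \<gg> br \<longleftrightarrow>
    fd_vectorspace \<gg> \<and> bilinear_map \<gg> \<gg> \<gg> br \<and>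
    (\<forall>x\<in>carrier \<gg>. br x x = \<zero>\<^bsub>\<gg>\<^esub>) \<and>
    (\<forall>x\<in>carrier \<gg>. \<forall>y\<in>carrier \<gg>. \<forall>z\<in>carrier \<gg>.
      br x (br y z) \<oplus>\<^bsub>\<gg>\<^esub> br y (br z x) \<oplus>\<^bsub>\<gg>\<^esub> br z (br x y) = \<zero>\<^bsub>\<gg>\<^esub>)"

definition compatible_lie_algebra ::
  "(complex, 'a) module \<Rightarrow> ('a \<Rightarrow> 'a \<Rightarrow> 'a) \<Rightarrow> ('a \<Rightarrow> 'a \<Rightarrow> 'a) \<Rightarrow> bool" where
  "compatible_lie_algebra \<gg> br1 br2 \<longleftrightarrow>
    lie_algebra \<gg> br1 \<and> lie_algebra \<gg> br2 \<and>
    (\<forall>k1 k2. lie_algebra \<gg> (pencil \<gg> k1 br1 k2 br2))"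

definition anti_pre_lie_algebra :: "(complex, 'a) module \<Rightarrow> ('a \<Rightarrow> 'a \<Rightarrow> 'a) \<Rightarrow> bool" where
  "anti_pre_lie_algebra A m \<longleftrightarrow>
    fd_vectorspace A \<and> bilinear_map A A A m \<and>
    (\<forall>x\<in>carrier A. \<forall>y\<in>carrier A. \<forall>z\<in>carrier A.
      m x (m y z) \<ominus>\<^bsub>A\<^esub> m y (m x z) = m (commutator A m y x) z) \<and>
    (\<forall>x\<in>carrier A. \<forall>y\<in>carrier A. \<forall>z\<in>carrier A.
      m (commutator A m x y) z \<oplus>\<^bsub>A\<^esub> m (commutator A m y z) x \<oplus>\<^bsub>A\<^esub> m (commutator A m z x) y
        = \<zero>\<^bsub>A\<^esub>)"

definition compatible_anti_pre_lie_algebra ::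
  "(complex, 'a) module \<Rightarrow> ('a \<Rightarrow> 'a \<Rightarrow> 'a) \<Rightarrow> ('a \<Rightarrow> 'a \<Rightarrow> 'a) \<Rightarrow> bool" where
  "compatible_anti_pre_lie_algebra A m1 m2 \<longleftrightarrow>
    anti_pre_lie_algebra A m1 \<and> anti_pre_lie_algebra A m2 \<and>
    (\<forall>k1 k2. anti_pre_lie_algebra A (pencil A k1 m1 k2 m2))"

definition compatible_anti_pre_lie_structure ::
  "(complex, 'a) module \<Rightarrow> ('a \<Rightarrow> 'a \<Rightarrow> 'a) \<Rightarrow> ('a \<Rightarrow> 'a \<Rightarrow> 'a) \<Rightarrow>
    ('a \<Rightarrow> 'a \<Rightarrow> 'a) \<Rightarrow> ('a \<Rightarrow> 'a \<Rightarrow> 'a) \<Rightarrow> bool" where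
  "compatible_anti_pre_lie_structure \<gg> br1 br2 m1 m2 \<longleftrightarrow>
    compatible_anti_pre_lie_algebra \<gg> m1 m2 \<and>
    (\<forall>x\<in>carrier \<gg>. \<forall>y\<in>carrier \<gg>.
      br1 x y = commutator \<gg> m1 x y \<and> br2 x y = commutator \<gg> m2 x y)"

text \<open>
  A linear map from a Lie algebra to the endomorphisms of \<open>V\<close> is given in curried form, that is,
  as a map that is linear in the algebra element and in the vector it acts on.
\<close>

definition lie_representation ::
  "(complex, 'a) module \<Rightarrow> ('a \<Rightarrow> 'a \<Rightarrow> 'a) \<Rightarrow> (complex, 'v) module \<Rightarrow> ('a \<Rightarrow> 'v \<Rightarrow> 'v) \<Rightarrow> bool"
  where
  "lie_representation \<gg> br V \<sigma> \<longleftrightarrow>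
    bilinear_map \<gg> V V \<sigma> \<and>
    (\<forall>x\<in>carrier \<gg>. \<forall>y\<in>carrier \<gg>. \<forall>v\<in>carrier V.
      \<sigma> (br x y) v = \<sigma> x (\<sigma> y v) \<ominus>\<^bsub>V\<^esub> \<sigma> y (\<sigma> x v))"

definition compatible_representation ::
  "(complex, 'a) module \<Rightarrow> ('a \<Rightarrow> 'a \<Rightarrow> 'a) \<Rightarrow> ('a \<Rightarrow> 'a \<Rightarrow> 'a) \<Rightarrow>
    (complex, 'v) module \<Rightarrow> ('a \<Rightarrow> 'v \<Rightarrow> 'v) \<Rightarrow> ('a \<Rightarrow> 'v \<Rightarrow> 'v) \<Rightarrow> bool" where
  "compatible_representation \<gg> br1 br2 V \<rho> \<mu> \<longleftrightarrow>
    fd_vectorspace V \<and> bilinear_map \<gg> V V \<rho> \<and> bilinear_map \<gg> V V \<mu> \<and>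
    (\<forall>k1 k2. lie_representation \<gg> (pencil \<gg> k1 br1 k2 br2) V (pencil V k1 \<rho> k2 \<mu>))"

definition anti_O_operator ::
  "(complex, 'a) module \<Rightarrow> ('a \<Rightarrow> 'a \<Rightarrow> 'a) \<Rightarrow> ('a \<Rightarrow> 'a \<Rightarrow> 'a) \<Rightarrow>
    (complex, 'v) module \<Rightarrow> ('a \<Rightarrow> 'v \<Rightarrow> 'v) \<Rightarrow> ('a \<Rightarrow> 'v \<Rightarrow> 'v) \<Rightarrow> ('v \<Rightarrow> 'a) \<Rightarrow> bool" where
  "anti_O_operator \<gg> br1 br2 V \<rho> \<mu> T \<longleftrightarrow>
    linear_map complex_field V \<gg> T \<and>
    (\<forall>k1 k2. \<forall>u\<in>carrier V. \<forall>v\<in>carrier V.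
      pencil \<gg> k1 br1 k2 br2 (T u) (T v) =
        T (pencil V k1 \<rho> k2 \<mu> (T v) u \<ominus>\<^bsub>V\<^esub> pencil V k1 \<rho> k2 \<mu> (T u) v))"

definition invertible_anti_O_operator ::
  "(complex, 'a) module \<Rightarrow> ('a \<Rightarrow> 'a \<Rightarrow> 'a) \<Rightarrow> ('a \<Rightarrow> 'a \<Rightarrow> 'a) \<Rightarrow>
    (complex, 'v) module \<Rightarrow> ('a \<Rightarrow> 'v \<Rightarrow> 'v) \<Rightarrow> ('a \<Rightarrow> 'v \<Rightarrow> 'v) \<Rightarrow> ('v \<Rightarrow> 'a) \<Rightarrow> bool" where
  "invertible_anti_O_operator \<gg> br1 br2 V \<rho> \<mu> T \<longleftrightarrow>
    anti_O_operator \<gg> br1 br2 V \<rho> \<mu> T \<and> bij_betw T (carrier V) (carrier \<gg>)"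

text \<open>
  HOL cannot quantify existentially over types.  The existence of a representation space therefore
  means: existence of a space with carrier in the type underlying the Lie algebra, when it is to be
  established, and existence of a space with carrier in an arbitrary type, when it is assumed.
\<close>

end

theory Submission
  imports Defs
begin

text \<open>
  Let \<open>br\<close> be a Lie bracket on \<open>\<gg>\<close> that is the commutator of a product \<open>m\<close>.  The first anti-pre-Lie
  identity, read through the left multiplications, is \<open>[L\<^sub>x, L\<^sub>y] = - L\<^bsub>[x,y]\<^esub>\<close>: it says exactly that
  \<open>x \<mapsto> - L\<^sub>x\<close> is a representation of \<open>(\<gg>, br)\<close> on \<open>\<gg>\<close>.  The second identity is then a consequence
  of the Jacobi identity (\<open>commutator_cyclic_sum_eq_zero\<close>).  So an anti-pre-Lie product that induces
  \<open>br\<close> is the same thing as a representation \<open>- L\<close> on \<open>\<gg>\<close> with \<open>br x y = L\<^sub>x y - L\<^sub>y x\<close>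
  (\<open>anti_pre_lie_iff_lie_representation\<close>), and the latter equation is the statement that the
  identity map of \<open>\<gg>\<close> is an anti-\<open>\<O>\<close>-operator for \<open>- L\<close>.

  This gives one direction with \<open>T = id\<close>, \<open>\<rho> = - L\<close> for the first product and \<open>\<mu> = - L\<close> for the
  second.  Conversely, an invertible \<open>T : V \<rightarrow> \<gg>\<close> carries a representation on \<open>V\<close> to one on \<open>\<gg>\<close>, and
  turns the anti-\<open>\<O>\<close>-equation of \<open>T\<close> into that of the identity; hence
  \<open>m x y = - T (\<sigma> x (T\<^sup>-\<^sup>1 y))\<close> is an anti-pre-Lie product with commutator \<open>br\<close>.

  Compatibility costs nothing more: the passage between \<open>m\<close> and \<open>\<sigma>\<close> is linear, so it commutes with
  forming pencils, and the argument for a single bracket applies to each member of the pencil.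
  The two given brackets are the members with parameters \<open>(1, 0)\<close> and \<open>(0, 1)\<close>, but only up to
  equality on the carrier; for this reason the lemmas on a single bracket ask that the maps involved
  agree on carriers rather than that they be equal functions.
\<close>

section \<open>Linear and bilinear maps\<close>

lemma linear_map_iff:
  "linear_map complex_field V W f \<longleftrightarrow>
    vectorspace complex_field V \<and> vectorspace complex_field W \<and>
    (\<forall>v\<in>carrier V. f v \<in> carrier W) \<and>
    (\<forall>u\<in>carrier V. \<forall>v\<in>carrier V. f (u \<oplus>\<^bsub>V\<^esub> v) = f u \<oplus>\<^bsub>W\<^esub> f v) \<and>
    (\<forall>c. \<forall>v\<in>carrier V. f (c \<odot>\<^bsub>V\<^esub> v) = c \<odot>\<^bsub>W\<^esub> f v)"
  by (auto simp: linear_map_def mod_hom_def mod_hom_axioms_def LinearCombinations.module_hom_def vectorspace_def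
      Pi_iff)

lemma bilinear_map_iff:
  assumes "vectorspace complex_field U" "vectorspace complex_field V" "vectorspace complex_field W"
  shows "bilinear_map U V W m \<longleftrightarrow>
    (\<forall>x\<in>carrier U. \<forall>y\<in>carrier V. m x y \<in> carrier W) \<and>
    (\<forall>x\<in>carrier U. \<forall>y\<in>carrier V. \<forall>z\<in>carrier V. m x (y \<oplus>\<^bsub>V\<^esub> z) = m x y \<oplus>\<^bsub>W\<^esub> m x z) \<and>
    (\<forall>c. \<forall>x\<in>carrier U. \<forall>y\<in>carrier V. m x (c \<odot>\<^bsub>V\<^esub> y) = c \<odot>\<^bsub>W\<^esub> m x y) \<and>
    (\<forall>x\<in>carrier U. \<forall>y\<in>carrier U. \<forall>z\<in>carrier V. m (x \<oplus>\<^bsub>U\<^esub> y) z = m x z \<oplus>\<^bsub>W\<^esub> m y z) \<and>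
    (\<forall>c. \<forall>x\<in>carrier U. \<forall>y\<in>carrier V. m (c \<odot>\<^bsub>U\<^esub> x) y = c \<odot>\<^bsub>W\<^esub> m x y)"
  unfolding bilinear_map_def linear_map_iff using assms by blast

lemma bilinear_map_minus:
  assumes "bilinear_map U V W m" "x \<in> carrier U"
  shows "y \<in> carrier V \<Longrightarrow> m x (\<ominus>\<^bsub>V\<^esub> y) = \<ominus>\<^bsub>W\<^esub> m x y"
    and "\<lbrakk>y \<in> carrier V; z \<in> carrier V\<rbrakk> \<Longrightarrow> m x (y \<ominus>\<^bsub>V\<^esub> z) = m x y \<ominus>\<^bsub>W\<^esub> m x z"
proof -
  interpret linear_map complex_field V W "m x"
    using assms by (simp add: bilinear_map_def)
  show "y \<in> carrier V \<Longrightarrow> m x (\<ominus>\<^bsub>V\<^esub> y) = \<ominus>\<^bsub>W\<^esub> m x y"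
    and "\<lbrakk>y \<in> carrier V; z \<in> carrier V\<rbrakk> \<Longrightarrow> m x (y \<ominus>\<^bsub>V\<^esub> z) = m x y \<ominus>\<^bsub>W\<^esub> m x z"
    by (simp_all add: T_neg T_minus)
qed

text \<open>The only place where the characteristic of the ground field enters.\<close>

lemma vectorspace_double_eq_zero:
  assumes "vectorspace complex_field V" "v \<in> carrier V" "v \<oplus>\<^bsub>V\<^esub> v = \<zero>\<^bsub>V\<^esub>"
  shows "v = \<zero>\<^bsub>V\<^esub>"
proof -
  interpret vectorspace complex_field V by fact
  have "v = (1/2 + 1/2 :: complex) \<odot>\<^bsub>V\<^esub> v"
    using assms(2) smult_one by simp
  also have "\<dots> = (1/2) \<odot>\<^bsub>V\<^esub> (v \<oplus>\<^bsub>V\<^esub> v)"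
    using assms(2) smult_l_distr[of "1/2" "1/2" v] smult_r_distr[of "1/2" v v] by simp
  also have "\<dots> = \<zero>\<^bsub>V\<^esub>"
    using assms(3) by simp
  finally show ?thesis .
qed

lemma (in abelian_group) sum_of_differences:
  assumes "a \<in> carrier G" "b \<in> carrier G" "c \<in> carrier G"
    and "a' \<in> carrier G" "b' \<in> carrier G" "c' \<in> carrier G"
  shows "(a \<ominus> a') \<oplus> (b \<ominus> b') \<oplus> (c \<ominus> c') = (a \<oplus> b \<oplus> c) \<ominus> (a' \<oplus> b' \<oplus> c')"
  using assms by (simp add: a_minus_def minus_add a_ac)

section \<open>Anti-pre-Lie products as representations\<close>

text \<open>
  Let \<open>S\<close> be the cyclic sum of the terms \<open>m [x,y] z\<close> and \<open>S'\<close> that of the terms \<open>m z [x,y]\<close>.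
  Expanding the outer bracket in \<open>S\<close> by \<open>anti\<close>, and the inner one in \<open>S'\<close> as a commutator, produces
  the same six products with opposite signs, so \<open>S = - S'\<close>.  On the other hand \<open>S' - S\<close> is the
  cyclic sum of the brackets \<open>[z, [x,y]]\<close>, which vanishes by the Jacobi identity.  Thus \<open>2 S = 0\<close>.
\<close>

lemma commutator_cyclic_sum_eq_zero:
  assumes lie: "lie_algebra \<gg> br"
    and bil: "bilinear_map \<gg> \<gg> \<gg> m"
    and comm: "\<And>x y. \<lbrakk>x \<in> carrier \<gg>; y \<in> carrier \<gg>\<rbrakk> \<Longrightarrow> br x y = commutator \<gg> m x y"
    and anti: "\<And>x y z. \<lbrakk>x \<in> carrier \<gg>; y \<in> carrier \<gg>; z \<in> carrier \<gg>\<rbrakk> \<Longrightarrow>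
      m (br x y) z = m y (m x z) \<ominus>\<^bsub>\<gg>\<^esub> m x (m y z)"
    and x: "x \<in> carrier \<gg>" and y: "y \<in> carrier \<gg>" and z: "z \<in> carrier \<gg>"
  shows "m (br x y) z \<oplus>\<^bsub>\<gg>\<^esub> m (br y z) x \<oplus>\<^bsub>\<gg>\<^esub> m (br z x) y = \<zero>\<^bsub>\<gg>\<^esub>"
proof -
  have vs: "vectorspace complex_field \<gg>"
    using lie by (simp add: lie_algebra_def fd_vectorspace_def)
  interpret vectorspace complex_field \<gg> by fact
  note xyz = x y z
  have m_closed [simp]: "m a b \<in> carrier \<gg>" if "a \<in> carrier \<gg>" "b \<in> carrier \<gg>" for a b
    using bil vs that by (simp add: bilinear_map_iff)
  have br_closed [simp]: "br a b \<in> carrier \<gg>" if "a \<in> carrier \<gg>" "b \<in> carrier \<gg>" for a b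
    using comm that by (simp add: commutator_def)
  define S where "S = m (br x y) z \<oplus>\<^bsub>\<gg>\<^esub> m (br y z) x \<oplus>\<^bsub>\<gg>\<^esub> m (br z x) y"
  define S' where "S' = m z (br x y) \<oplus>\<^bsub>\<gg>\<^esub> m x (br y z) \<oplus>\<^bsub>\<gg>\<^esub> m y (br z x)"
  have S_closed [simp]: "S \<in> carrier \<gg>" and S'_closed [simp]: "S' \<in> carrier \<gg>"
    using xyz by (simp_all add: S_def S'_def)
  have br_eq: "m a (br b c) = m a (m b c) \<ominus>\<^bsub>\<gg>\<^esub> m a (m c b)"
    if "a \<in> carrier \<gg>" "b \<in> carrier \<gg>" "c \<in> carrier \<gg>" for a b c
    using that comm[of b c] bilinear_map_minus(2)[OF bil, of a "m b c" "m c b"]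
    by (simp add: commutator_def)
  have "S = \<ominus>\<^bsub>\<gg>\<^esub> S'"
    using xyz unfolding S_def S'_def
    by (simp add: anti br_eq sum_of_differences)
       (simp add: a_minus_def minus_add a_ac)
  moreover have "S = S'"
  proof -
    have jac: "br x (br y z) \<oplus>\<^bsub>\<gg>\<^esub> br y (br z x) \<oplus>\<^bsub>\<gg>\<^esub> br z (br x y) = \<zero>\<^bsub>\<gg>\<^esub>"
      using lie xyz by (simp add: lie_algebra_def)
    have "br z (br x y) \<oplus>\<^bsub>\<gg>\<^esub> br x (br y z) \<oplus>\<^bsub>\<gg>\<^esub> br y (br z x) = \<zero>\<^bsub>\<gg>\<^esub>"
      unfolding jac[symmetric] using xyz by (simp add: a_ac)
    hence "S' \<ominus>\<^bsub>\<gg>\<^esub> S = \<zero>\<^bsub>\<gg>\<^esub>"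
      using xyz comm unfolding S_def S'_def
      by (simp add: sum_of_differences[symmetric] comm[of _ "br _ _"] commutator_def)
    thus ?thesis
      by (metis S_closed S'_closed a_inv_closed a_minus_def minus_equality minus_minus)
  qed
  ultimately have "S \<oplus>\<^bsub>\<gg>\<^esub> S = \<zero>\<^bsub>\<gg>\<^esub>"
    by (metis S_closed r_neg)
  thus ?thesis
    using vectorspace_double_eq_zero[OF vs S_closed] by (simp add: S_def)
qed

text \<open>
  Two minus signs cancel in \<open>\<sigma> x (\<sigma> y z)\<close> while one survives in \<open>\<sigma> (br x y) z\<close>; this sign is what
  turns the identity of a representation into the first anti-pre-Lie identity.
\<close>

lemma anti_pre_lie_iff_lie_representation:
  assumes lie: "lie_algebra \<gg> br"
    and comm: "\<And>x y. \<lbrakk>x \<in> carrier \<gg>; y \<in> carrier \<gg>\<rbrakk> \<Longrightarrow> br x y = commutator \<gg> m x y"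
    and neg: "\<And>x y. \<lbrakk>x \<in> carrier \<gg>; y \<in> carrier \<gg>\<rbrakk> \<Longrightarrow>
      m x y \<in> carrier \<gg> \<and> \<sigma> x y = \<ominus>\<^bsub>\<gg>\<^esub> m x y"
  shows "anti_pre_lie_algebra \<gg> m \<longleftrightarrow> lie_representation \<gg> br \<gg> \<sigma>"
proof -
  have fd: "fd_vectorspace \<gg>"
    using lie by (simp add: lie_algebra_def)
  hence vs: "vectorspace complex_field \<gg>"
    by (simp add: fd_vectorspace_def)
  interpret vectorspace complex_field \<gg> by fact
  have m_closed [simp]: "m a b \<in> carrier \<gg>" if "a \<in> carrier \<gg>" "b \<in> carrier \<gg>" for a b
    using neg that by blast
  have neg': "\<sigma> a b = \<ominus>\<^bsub>\<gg>\<^esub> m a b" if "a \<in> carrier \<gg>" "b \<in> carrier \<gg>" for a b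
    using neg that by blast
  have br_closed [simp]: "br a b \<in> carrier \<gg>" if "a \<in> carrier \<gg>" "b \<in> carrier \<gg>" for a b
    using comm that by (simp add: commutator_def)
  have smult_neg: "c \<odot>\<^bsub>\<gg>\<^esub> (\<ominus>\<^bsub>\<gg>\<^esub> v) = \<ominus>\<^bsub>\<gg>\<^esub> (c \<odot>\<^bsub>\<gg>\<^esub> v)" if "v \<in> carrier \<gg>" for c v
    using smult_r_minus[of c v] that by simp
  have minus_inj: "\<ominus>\<^bsub>\<gg>\<^esub> a = \<ominus>\<^bsub>\<gg>\<^esub> b \<longleftrightarrow> a = b" if "a \<in> carrier \<gg>" "b \<in> carrier \<gg>" for a b
    using that by (metis minus_minus)
  have bil_iff: "bilinear_map \<gg> \<gg> \<gg> \<sigma> \<longleftrightarrow> bilinear_map \<gg> \<gg> \<gg> m"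
    by (simp add: bilinear_map_iff[OF vs vs vs] neg' smult_neg minus_inj minus_add[symmetric])
  have rep_iff: "\<sigma> (br x y) z = \<sigma> x (\<sigma> y z) \<ominus>\<^bsub>\<gg>\<^esub> \<sigma> y (\<sigma> x z) \<longleftrightarrow>
      m (br x y) z = m y (m x z) \<ominus>\<^bsub>\<gg>\<^esub> m x (m y z)"
    if "bilinear_map \<gg> \<gg> \<gg> m" "x \<in> carrier \<gg>" "y \<in> carrier \<gg>" "z \<in> carrier \<gg>" for x y z
  proof -
    have "\<sigma> x (\<sigma> y z) \<ominus>\<^bsub>\<gg>\<^esub> \<sigma> y (\<sigma> x z) = m x (m y z) \<ominus>\<^bsub>\<gg>\<^esub> m y (m x z)"
      using that(2-) by (simp add: neg' bilinear_map_minus(1)[OF that(1)])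
    also have "\<dots> = \<ominus>\<^bsub>\<gg>\<^esub> (m y (m x z) \<ominus>\<^bsub>\<gg>\<^esub> m x (m y z))"
      using that(2-) by (simp add: a_minus_def minus_add a_ac)
    finally show ?thesis
      using that(2-) by (simp add: neg' minus_inj)
  qed
  have apl_iff: "m x (m y z) \<ominus>\<^bsub>\<gg>\<^esub> m y (m x z) = m (commutator \<gg> m y x) z \<longleftrightarrow>
      m (br y x) z = m x (m y z) \<ominus>\<^bsub>\<gg>\<^esub> m y (m x z)"
    if "x \<in> carrier \<gg>" "y \<in> carrier \<gg>" for x y z
    using comm that by auto
  show ?thesis
  proof
    assume apl: "anti_pre_lie_algebra \<gg> m"
    hence bil: "bilinear_map \<gg> \<gg> \<gg> m"
      by (simp add: anti_pre_lie_algebra_def)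
    show "lie_representation \<gg> br \<gg> \<sigma>"
      using apl bil unfolding lie_representation_def anti_pre_lie_algebra_def
      by (auto simp: bil_iff rep_iff apl_iff)
  next
    assume rep: "lie_representation \<gg> br \<gg> \<sigma>"
    hence bil: "bilinear_map \<gg> \<gg> \<gg> m"
      by (simp add: lie_representation_def bil_iff)
    have anti: "m (br x y) z = m y (m x z) \<ominus>\<^bsub>\<gg>\<^esub> m x (m y z)"
      if "x \<in> carrier \<gg>" "y \<in> carrier \<gg>" "z \<in> carrier \<gg>" for x y z
      using rep rep_iff[OF bil that] that by (simp add: lie_representation_def)
    show "anti_pre_lie_algebra \<gg> m"
      using fd bil anti commutator_cyclic_sum_eq_zero[OF lie bil comm anti]
      unfolding anti_pre_lie_algebra_def
      by (simp add: apl_iff comm[symmetric])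
  qed
qed

section \<open>Transport along an invertible operator\<close>

lemma linear_map_inv_into:
  assumes T: "linear_map complex_field V W T" and bij: "bij_betw T (carrier V) (carrier W)"
  shows "linear_map complex_field W V (inv_into (carrier V) T)"
proof -
  let ?S = "inv_into (carrier V) T"
  note Tl = T[unfolded linear_map_iff]
  interpret V: vectorspace complex_field V using Tl by blast
  have S_closed: "?S w \<in> carrier V" if "w \<in> carrier W" for w
    using bij that by (metis bij_betw_imp_surj_on inv_into_into)
  have TS: "T (?S w) = w" if "w \<in> carrier W" for w
    using bij that by (metis bij_betw_inv_into_right)
  have S_eqI: "?S w = v" if "v \<in> carrier V" "T v = w" for v w
    using bij that by (metis bij_betw_inv_into_left)
  show ?thesis
    unfolding linear_map_iff using Tl S_closed TS
    by (auto intro!: S_eqI V.smult_closed)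
qed

lemma lie_representation_transport:
  assumes rep: "lie_representation \<gg> br V \<sigma>"
    and T: "linear_map complex_field V W T" and bij: "bij_betw T (carrier V) (carrier W)"
    and g: "vectorspace complex_field \<gg>"
  shows "lie_representation \<gg> br W (\<lambda>x w. T (\<sigma> x (inv_into (carrier V) T w)))"
proof -
  let ?S = "inv_into (carrier V) T"
  interpret T: linear_map complex_field V W T by fact
  note Tl = T[unfolded linear_map_iff]
  note Sl = linear_map_inv_into[OF T bij, unfolded linear_map_iff]
  have ST: "?S (T v) = v" if "v \<in> carrier V" for v
    using bij that by (metis bij_betw_inv_into_left)
  have V: "vectorspace complex_field V" and W: "vectorspace complex_field W"
    using Tl by auto
  have bil: "bilinear_map \<gg> V V \<sigma>"
    using rep by (simp add: lie_representation_def)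
  note bl = bil[unfolded bilinear_map_iff[OF g V V]]
  show ?thesis
    using rep Tl Sl bl unfolding lie_representation_def bilinear_map_iff[OF g W W]
    by (simp add: ST T.T_minus)
qed

text \<open>
  With \<open>u = T\<^sup>-\<^sup>1 x\<close> and \<open>v = T\<^sup>-\<^sup>1 y\<close> the anti-\<open>\<O>\<close>-equation reads \<open>br x y = m x y - m y x\<close>, and the
  representation transported to \<open>\<gg>\<close> is \<open>x \<mapsto> - m x\<close>.
\<close>

lemma anti_pre_lie_of_invertible_anti_O:
  assumes lie: "lie_algebra \<gg> br" and rep: "lie_representation \<gg> br V \<sigma>"
    and T: "linear_map complex_field V \<gg> T" and bij: "bij_betw T (carrier V) (carrier \<gg>)"
    and anti_O: "\<And>u v. \<lbrakk>u \<in> carrier V; v \<in> carrier V\<rbrakk> \<Longrightarrow>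
      br (T u) (T v) = T (\<sigma> (T v) u \<ominus>\<^bsub>V\<^esub> \<sigma> (T u) v)"
    and m: "\<And>x y. \<lbrakk>x \<in> carrier \<gg>; y \<in> carrier \<gg>\<rbrakk> \<Longrightarrow>
      m x y = \<ominus>\<^bsub>\<gg>\<^esub> T (\<sigma> x (inv_into (carrier V) T y))"
  shows "anti_pre_lie_algebra \<gg> m"
    and "\<And>x y. \<lbrakk>x \<in> carrier \<gg>; y \<in> carrier \<gg>\<rbrakk> \<Longrightarrow> br x y = commutator \<gg> m x y"
proof -
  let ?S = "inv_into (carrier V) T"
  have V: "vectorspace complex_field V" and g: "vectorspace complex_field \<gg>"
    using T unfolding linear_map_iff by auto
  interpret V: vectorspace complex_field V by fact
  interpret \<gg>: vectorspace complex_field \<gg> by fact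
  interpret T: linear_map complex_field V \<gg> T by fact
  have S_closed: "?S w \<in> carrier V" if "w \<in> carrier \<gg>" for w
    using bij that by (metis bij_betw_imp_surj_on inv_into_into)
  have TS: "T (?S w) = w" if "w \<in> carrier \<gg>" for w
    using bij that by (metis bij_betw_inv_into_right)
  have \<sigma>_closed: "\<sigma> x v \<in> carrier V" if "x \<in> carrier \<gg>" "v \<in> carrier V" for x v
    using rep that by (simp add: lie_representation_def bilinear_map_iff[OF g V V])
  show comm: "br x y = commutator \<gg> m x y" if "x \<in> carrier \<gg>" "y \<in> carrier \<gg>" for x y
  proof -
    have "br x y = T (\<sigma> y (?S x)) \<ominus>\<^bsub>\<gg>\<^esub> T (\<sigma> x (?S y))"
      using anti_O[of "?S x" "?S y"] that by (simp add: S_closed TS \<sigma>_closed T.T_minus)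
    thus ?thesis
      using that S_closed \<sigma>_closed T.T_im
      by (simp add: commutator_def m a_minus_def \<gg>.minus_minus \<gg>.a_comm)
  qed
  have "anti_pre_lie_algebra \<gg> m \<longleftrightarrow> lie_representation \<gg> br \<gg> (\<lambda>x w. T (\<sigma> x (?S w)))"
    by (rule anti_pre_lie_iff_lie_representation[OF lie comm])
       (auto simp: m S_closed \<sigma>_closed \<gg>.minus_minus)
  thus "anti_pre_lie_algebra \<gg> m"
    using lie_representation_transport[OF rep T bij g] by simp
qed

section \<open>Pencils\<close>

lemma pencil_one_zero:
  assumes "vectorspace complex_field W" "m1 x y \<in> carrier W" "m2 x y \<in> carrier W"
  shows "pencil W 1 m1 0 m2 x y = m1 x y" and "pencil W 0 m1 1 m2 x y = m2 x y"
proof -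
  interpret vectorspace complex_field W by fact
  show "pencil W 1 m1 0 m2 x y = m1 x y" "pencil W 0 m1 1 m2 x y = m2 x y"
    using assms(2,3) smult_one lmult_0 by (simp_all add: pencil_def)
qed

lemma pencil_neg:
  assumes "vectorspace complex_field W" "m1 x y \<in> carrier W" "m2 x y \<in> carrier W"
  shows "pencil W k1 (\<lambda>x y. \<ominus>\<^bsub>W\<^esub> m1 x y) k2 (\<lambda>x y. \<ominus>\<^bsub>W\<^esub> m2 x y) x y = \<ominus>\<^bsub>W\<^esub> pencil W k1 m1 k2 m2 x y"
proof -
  interpret vectorspace complex_field W by fact
  show ?thesis
    using assms(2,3) smult_r_minus[of k1] smult_r_minus[of k2] by (simp add: pencil_def minus_add)
qed

lemma pencil_commutator:
  assumes "vectorspace complex_field A" "m1 x y \<in> carrier A" "m1 y x \<in> carrier A"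
    "m2 x y \<in> carrier A" "m2 y x \<in> carrier A"
  shows "pencil A k1 (commutator A m1) k2 (commutator A m2) x y =
    commutator A (pencil A k1 m1 k2 m2) x y"
proof -
  interpret vectorspace complex_field A by fact
  show ?thesis
    using assms(2-) smult_r_minus[of k1] smult_r_minus[of k2]
    by (simp add: pencil_def commutator_def a_minus_def smult_r_distr minus_add a_ac)
qed

section \<open>Compatible structures\<close>

lemma anti_O_operator_of_structure:
  assumes "compatible_lie_algebra \<gg> br1 br2" "compatible_anti_pre_lie_structure \<gg> br1 br2 m1 m2"
  defines "\<rho> \<equiv> \<lambda>x y. \<ominus>\<^bsub>\<gg>\<^esub> m1 x y" and "\<mu> \<equiv> \<lambda>x y. \<ominus>\<^bsub>\<gg>\<^esub> m2 x y"
  shows "compatible_representation \<gg> br1 br2 \<gg> \<rho> \<mu>"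
    and "invertible_anti_O_operator \<gg> br1 br2 \<gg> \<rho> \<mu> id"
proof -
  have fd: "fd_vectorspace \<gg>" and lie1: "lie_algebra \<gg> br1" and lie2: "lie_algebra \<gg> br2"
    and lie: "\<And>k1 k2. lie_algebra \<gg> (pencil \<gg> k1 br1 k2 br2)"
    using assms(1) by (auto simp: compatible_lie_algebra_def lie_algebra_def)
  from fd have vs: "vectorspace complex_field \<gg>"
    by (simp add: fd_vectorspace_def)
  interpret vectorspace complex_field \<gg> by fact
  have apl1: "anti_pre_lie_algebra \<gg> m1" and apl2: "anti_pre_lie_algebra \<gg> m2"
    and apl: "\<And>k1 k2. anti_pre_lie_algebra \<gg> (pencil \<gg> k1 m1 k2 m2)"
    and comm1: "\<And>x y. \<lbrakk>x \<in> carrier \<gg>; y \<in> carrier \<gg>\<rbrakk> \<Longrightarrow> br1 x y = commutator \<gg> m1 x y"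
    and comm2: "\<And>x y. \<lbrakk>x \<in> carrier \<gg>; y \<in> carrier \<gg>\<rbrakk> \<Longrightarrow> br2 x y = commutator \<gg> m2 x y"
    using assms(2)
    by (auto simp: compatible_anti_pre_lie_structure_def compatible_anti_pre_lie_algebra_def)
  have closed: "m1 x y \<in> carrier \<gg>" "m2 x y \<in> carrier \<gg>" "pencil \<gg> k1 m1 k2 m2 x y \<in> carrier \<gg>"
    if "x \<in> carrier \<gg>" "y \<in> carrier \<gg>" for x y k1 k2
    using that apl1 apl2 apl
    by (simp_all add: anti_pre_lie_algebra_def bilinear_map_iff[OF vs vs vs])
  have comm: "pencil \<gg> k1 br1 k2 br2 x y = commutator \<gg> (pencil \<gg> k1 m1 k2 m2) x y"
    if "x \<in> carrier \<gg>" "y \<in> carrier \<gg>" for k1 k2 x y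
    using pencil_commutator[OF vs, of m1 x y m2 k1 k2] that closed
    by (simp add: pencil_def comm1 comm2)
  have neg: "pencil \<gg> k1 \<rho> k2 \<mu> x y = \<ominus>\<^bsub>\<gg>\<^esub> pencil \<gg> k1 m1 k2 m2 x y"
    if "x \<in> carrier \<gg>" "y \<in> carrier \<gg>" for k1 k2 x y
    unfolding \<rho>_def \<mu>_def by (rule pencil_neg[OF vs]) (use that closed in auto)
  have rep: "lie_representation \<gg> (pencil \<gg> k1 br1 k2 br2) \<gg> (pencil \<gg> k1 \<rho> k2 \<mu>)" for k1 k2
    by (rule iffD1[OF anti_pre_lie_iff_lie_representation[OF lie comm] apl])
       (simp_all add: closed(3) neg)
  have "lie_representation \<gg> br1 \<gg> \<rho>" "lie_representation \<gg> br2 \<gg> \<mu>"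
    by (rule iffD1[OF anti_pre_lie_iff_lie_representation[OF lie1 comm1] apl1];
        simp add: closed \<rho>_def)
       (rule iffD1[OF anti_pre_lie_iff_lie_representation[OF lie2 comm2] apl2];
        simp add: closed \<mu>_def)
  thus "compatible_representation \<gg> br1 br2 \<gg> \<rho> \<mu>"
    using fd rep by (simp add: compatible_representation_def lie_representation_def)
  have "linear_map complex_field \<gg> \<gg> id"
    using vs by (simp add: linear_map_iff)
  moreover have "pencil \<gg> k1 br1 k2 br2 u v = pencil \<gg> k1 \<rho> k2 \<mu> v u \<ominus>\<^bsub>\<gg>\<^esub> pencil \<gg> k1 \<rho> k2 \<mu> u v"
    if "u \<in> carrier \<gg>" "v \<in> carrier \<gg>" for k1 k2 u v
    using that closed(3) by (simp add: comm neg commutator_def a_minus_def a_comm)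
  ultimately show "invertible_anti_O_operator \<gg> br1 br2 \<gg> \<rho> \<mu> id"
    by (simp add: invertible_anti_O_operator_def anti_O_operator_def)
qed

lemma structure_of_anti_O_operator:
  assumes "compatible_lie_algebra \<gg> br1 br2" "compatible_representation \<gg> br1 br2 V \<rho> \<mu>"
    and "invertible_anti_O_operator \<gg> br1 br2 V \<rho> \<mu> T"
  shows "compatible_anti_pre_lie_structure \<gg> br1 br2
    (\<lambda>x y. \<ominus>\<^bsub>\<gg>\<^esub> T (\<rho> x (inv_into (carrier V) T y)))
    (\<lambda>x y. \<ominus>\<^bsub>\<gg>\<^esub> T (\<mu> x (inv_into (carrier V) T y)))"
proof -
  let ?S = "inv_into (carrier V) T"
  define m1 where "m1 = (\<lambda>x y. \<ominus>\<^bsub>\<gg>\<^esub> T (\<rho> x (?S y)))"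
  define m2 where "m2 = (\<lambda>x y. \<ominus>\<^bsub>\<gg>\<^esub> T (\<mu> x (?S y)))"
  have lie1: "lie_algebra \<gg> br1" and lie2: "lie_algebra \<gg> br2"
    and lie: "\<And>k1 k2. lie_algebra \<gg> (pencil \<gg> k1 br1 k2 br2)"
    using assms(1) by (auto simp: compatible_lie_algebra_def)
  have rep: "\<And>k1 k2. lie_representation \<gg> (pencil \<gg> k1 br1 k2 br2) V (pencil V k1 \<rho> k2 \<mu>)"
    and bil: "bilinear_map \<gg> V V \<rho>" "bilinear_map \<gg> V V \<mu>"
    using assms(2) by (auto simp: compatible_representation_def)
  have T: "linear_map complex_field V \<gg> T" and bij: "bij_betw T (carrier V) (carrier \<gg>)"
    and anti_O: "\<And>k1 k2 u v. \<lbrakk>u \<in> carrier V; v \<in> carrier V\<rbrakk> \<Longrightarrow>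
      pencil \<gg> k1 br1 k2 br2 (T u) (T v) =
        T (pencil V k1 \<rho> k2 \<mu> (T v) u \<ominus>\<^bsub>V\<^esub> pencil V k1 \<rho> k2 \<mu> (T u) v)"
    using assms(3) by (auto simp: invertible_anti_O_operator_def anti_O_operator_def)
  have V: "vectorspace complex_field V" and g: "vectorspace complex_field \<gg>"
    using T unfolding linear_map_iff by auto
  interpret V: vectorspace complex_field V by fact
  interpret \<gg>: vectorspace complex_field \<gg> by fact
  interpret T: linear_map complex_field V \<gg> T by fact
  have S_closed: "?S w \<in> carrier V" if "w \<in> carrier \<gg>" for w
    using bij that by (metis bij_betw_imp_surj_on inv_into_into)
  have act_closed: "\<rho> x v \<in> carrier V" "\<mu> x v \<in> carrier V" if "x \<in> carrier \<gg>" "v \<in> carrier V" for x v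
    using bil that by (simp_all add: bilinear_map_iff[OF g V V])
  have br_closed: "br1 x y \<in> carrier \<gg>" "br2 x y \<in> carrier \<gg>"
    if "x \<in> carrier \<gg>" "y \<in> carrier \<gg>" for x y
    using lie1 lie2 that by (simp_all add: lie_algebra_def bilinear_map_iff[OF g g g])
  have pencil_m: "pencil \<gg> k1 m1 k2 m2 x y = \<ominus>\<^bsub>\<gg>\<^esub> T (pencil V k1 \<rho> k2 \<mu> x (?S y))"
    if "x \<in> carrier \<gg>" "y \<in> carrier \<gg>" for k1 k2 x y
  proof -
    have "T (pencil V k1 \<rho> k2 \<mu> x (?S y)) =
        pencil \<gg> k1 (\<lambda>x y. T (\<rho> x (?S y))) k2 (\<lambda>x y. T (\<mu> x (?S y))) x y"
      using that by (simp add: pencil_def T.T_add T.T_smult S_closed act_closed V.smult_closed)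
    moreover have "pencil \<gg> k1 m1 k2 m2 x y =
        \<ominus>\<^bsub>\<gg>\<^esub> pencil \<gg> k1 (\<lambda>x y. T (\<rho> x (?S y))) k2 (\<lambda>x y. T (\<mu> x (?S y))) x y"
      unfolding m1_def m2_def
      by (rule pencil_neg[OF g]) (use that S_closed act_closed T.T_im in auto)
    ultimately show ?thesis by simp
  qed
  \<comment> \<open>Each product is itself a member of the pencil, which makes the single-bracket result applicable.\<close>
  have m_eq: "m1 x y = \<ominus>\<^bsub>\<gg>\<^esub> T (pencil V 1 \<rho> 0 \<mu> x (?S y))"
      "m2 x y = \<ominus>\<^bsub>\<gg>\<^esub> T (pencil V 0 \<rho> 1 \<mu> x (?S y))"
    if "x \<in> carrier \<gg>" "y \<in> carrier \<gg>" for x y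
    using that by (simp_all add: m1_def m2_def pencil_one_zero[OF V] S_closed act_closed)
  have "anti_pre_lie_algebra \<gg> m1" "anti_pre_lie_algebra \<gg> m2"
    "\<And>k1 k2. anti_pre_lie_algebra \<gg> (pencil \<gg> k1 m1 k2 m2)"
    using anti_pre_lie_of_invertible_anti_O(1)[OF lie rep T bij anti_O m_eq(1)]
      anti_pre_lie_of_invertible_anti_O(1)[OF lie rep T bij anti_O m_eq(2)]
      anti_pre_lie_of_invertible_anti_O(1)[OF lie rep T bij anti_O pencil_m] by blast+
  moreover have "br1 x y = commutator \<gg> m1 x y" "br2 x y = commutator \<gg> m2 x y"
    if xy: "x \<in> carrier \<gg>" "y \<in> carrier \<gg>" for x y
    using anti_pre_lie_of_invertible_anti_O(2)[OF lie rep T bij anti_O m_eq(1) xy]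
      anti_pre_lie_of_invertible_anti_O(2)[OF lie rep T bij anti_O m_eq(2) xy]
      pencil_one_zero[OF g, of br1 x y br2, OF br_closed[OF xy]]
    by simp_all
  ultimately show ?thesis
    unfolding m1_def[symmetric] m2_def[symmetric]
    by (simp add: compatible_anti_pre_lie_structure_def compatible_anti_pre_lie_algebra_def)
qed

theorem corollary3p6:
  fixes \<gg> :: "(complex, 'a) module" and br1 br2 :: "'a \<Rightarrow> 'a \<Rightarrow> 'a"
  assumes "compatible_lie_algebra \<gg> br1 br2"
  shows "((\<exists>m1 m2. compatible_anti_pre_lie_structure \<gg> br1 br2 m1 m2) \<longleftrightarrow>
          (\<exists>(V :: (complex, 'a) module) \<rho> \<mu> T.
             compatible_representation \<gg> br1 br2 V \<rho> \<mu> \<and>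
             invertible_anti_O_operator \<gg> br1 br2 V \<rho> \<mu> T)) \<and>
         ((\<exists>(V :: (complex, 'v) module) \<rho> \<mu> T.
             compatible_representation \<gg> br1 br2 V \<rho> \<mu> \<and>
             invertible_anti_O_operator \<gg> br1 br2 V \<rho> \<mu> T) \<longrightarrow>
          (\<exists>m1 m2. compatible_anti_pre_lie_structure \<gg> br1 br2 m1 m2))"
  using anti_O_operator_of_structure[OF assms] structure_of_anti_O_operator[OF assms] by metis

end
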